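(* Let $a,b$ be integers with $2 \leq a \leq b$ and let $e = (\log b)/(\log a)$. Then for all integers $n \geq 0$, $$\frac{a-1}{b-1}\, n^e \;\leq\; \frac{a-1}{b-1}\big((n+1)^e - 1\big) \;\leq\; [(n)_a]_b \;\leq\; n^e .$$
   Context: For an integer $c \geq 2$, $(n)_c$ denotes the most-significant-digit-first base-$c$ representation of $n \in \mathbb{N}$ with no leading zeros (the empty word for $n=0$), a word over the digit set $\{0,1,\ldots,c-1\}$. For a word $x = a_1 a_2 \cdots a_t$ over digits, $[x]_b = \sum_{i=1}^{t} a_i b^{t-i}$. Thus $[(n)_a]_b$ is obtained by writing $n$ in base $a$ and reading the resulting digit string in base $b$. *)

theory Defs
  imports Complex_Main
begin

text \<open>Words are digit lists with the most significant digit first; the test \<open>c < 2\<close> only makes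
  the function total (bases below 2 get the junk value \<open>[]\<close>).\<close>

function base_rep :: "nat \<Rightarrow> nat \<Rightarrow> nat list" where
  "base_rep c n = (if c < 2 \<or> n = 0 then [] else base_rep c (n div c) @ [n mod c])"
  by auto
termination
  by (relation "measure snd") auto

declare base_rep.simps [simp del]

text \<open>The digit written \<open>a\<^sub>i\<close> in \<open>x = a\<^sub>1 \<dots> a\<^sub>t\<close> is \<open>x ! (i - 1)\<close>. Digits need not be below
  the base \<open>b\<close>.\<close>

definition word_val :: "nat \<Rightarrow> nat list \<Rightarrow> nat" where
  "word_val b x = (\<Sum>i = 1..length x. x ! (i - 1) * b ^ (length x - i))"

lemma word_val_Nil: "word_val b [] = 0"
  by (simp add: word_val_def)

lemma word_val_snoc: "word_val b (x @ [d]) = b * word_val b x + d"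
proof -
  have "(\<Sum>i = 1..length x. (x @ [d]) ! (i - 1) * b ^ (Suc (length x) - i))
      = (\<Sum>i = 1..length x. b * (x ! (i - 1) * b ^ (length x - i)))"
    by (rule sum.cong) (auto simp: nth_append Suc_diff_le)
  then show ?thesis
    by (simp add: word_val_def sum_distrib_left)
qed

text \<open>The following three facts characterise \<open>base_rep c n\<close> as the base-\<open>c\<close> representation of
  \<open>n\<close> without leading zeros.\<close>

lemma word_val_base_rep:
  assumes "2 \<le> c"
  shows "word_val c (base_rep c n) = n"
  using assms
proof (induction c n rule: base_rep.induct)
  case (1 c n)
  then show ?case
    by (cases "n = 0") (simp_all add: base_rep.simps [of c n] base_rep.simps [of c 0] word_val_Nil word_val_snoc)
qed

lemma base_rep_digits:
  assumes "2 \<le> c"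
  shows "set (base_rep c n) \<subseteq> {..<c}"
  using assms
proof (induction c n rule: base_rep.induct)
  case (1 c n)
  then show ?case
    by (cases "n = 0") (simp_all add: base_rep.simps [of c n] base_rep.simps [of c 0])
qed

lemma hd_base_rep:
  assumes "2 \<le> c" "n > 0"
  shows "base_rep c n \<noteq> [] \<and> hd (base_rep c n) \<noteq> 0"
  using assms
proof (induction c n rule: base_rep.induct)
  case (1 c n)
  show ?case
  proof (cases "n < c")
    case True
    then show ?thesis
      using 1 by (simp add: base_rep.simps [of c n] base_rep.simps [of c 0])
  next
    case False
    then have "n div c > 0"
      using 1 by (simp add: div_greater_zero_iff)
    then show ?thesis
      using 1 by (simp add: base_rep.simps [of c n])
  qed
qed

end

theory Submission
  imports Defs "HOL-Analysis.Convex"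
begin

text \<open>Since \<open>a powr e = b\<close>, both nontrivial bounds follow by induction along \<open>n = a * m + d\<close>,
  where the value \<open>F n\<close> satisfies \<open>F n = b * F m + d\<close>. For the upper bound the step is
  \<open>(a * m) powr e + d \<le> (a * m + d) powr e\<close>, i.e. superadditivity of \<open>x powr e\<close> for \<open>e \<ge> 1\<close>.
  For the lower bound the step says that the slope of \<open>x powr e\<close> over \<open>[a * m + d + 1, a * m + a]\<close>
  is at least \<open>(b - 1) / (a - 1)\<close>; this is its slope over \<open>[1, a]\<close>, so convexity suffices.\<close>

text \<open>The slope over \<open>[s, v]\<close> lies between the two: moving the right end from
  \<open>t\<close> to \<open>v\<close>, then the left end from \<open>s\<close> to \<open>u\<close>,
  can only raise the slope. The intervals may overlap.\<close>

lemma convex_on_slope_mono: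
  fixes f :: "real \<Rightarrow> real"
  assumes f: "convex_on I f" and I: "s \<in> I" "t \<in> I" "u \<in> I" "v \<in> I"
    and le: "s < t" "s \<le> u" "t \<le> v" "u < v"
  shows "(f t - f s) / (t - s) \<le> (f v - f u) / (v - u)"
proof -
  have flip: "(f p - f q) / (p - q) = (f q - f p) / (q - p)" for p q
    by (metis minus_diff_eq minus_divide_divide)
  have "(f t - f s) / (t - s) \<le> (f v - f s) / (v - s)"
    using convex_on_slope_le(1)[OF f I(1,4) le(1)] le flip[of s t] flip[of s v]
    by (cases "t = v") auto
  also have "\<dots> \<le> (f v - f u) / (v - u)"
    using convex_on_slope_le(2)[OF f I(1,4) _ le(4)] le flip[of s v] flip[of u v]
    by (cases "s = u") auto
  finally show ?thesis .
qed

text \<open>Write \<open>z powr p\<close> as \<open>z * z powr (p - 1)\<close>; since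
  \<open>p - 1\<close> is nonnegative, both second factors grow when their base is raised to
  \<open>x + y\<close>.\<close>

lemma powr_superadditive:
  fixes x y p :: real
  assumes "0 \<le> x" "0 \<le> y" "1 \<le> p"
  shows "x powr p + y powr p \<le> (x + y) powr p"
proof -
  have split: "z powr p = z * z powr (p - 1)" if "0 \<le> z" for z :: real
    using powr_mult_base[OF that, of "p - 1"] by simp
  have "x powr p + y powr p = x * x powr (p - 1) + y * y powr (p - 1)"
    using assms split by simp
  also have "\<dots> \<le> x * (x + y) powr (p - 1) + y * (x + y) powr (p - 1)"
    using assms by (intro add_mono mult_left_mono powr_mono2) auto
  also have "\<dots> = (x + y) powr p"
    using assms split[of "x + y"] by (simp add: distrib_right)
  finally show ?thesis .
qed

lemma powr_add_nat_le:
  fixes x p :: real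
  assumes "0 \<le> x" "1 \<le> p"
  shows "x powr p + real k \<le> (x + real k) powr p"
proof -
  \<comment> \<open>Integrality matters here: this fails for reals strictly between 0 and 1 when
    \<open>p > 1\<close>.\<close>
  have "real k \<le> real k powr p"
    using assms powr_mono[of 1 p "real k"] by (cases "k = 0") auto
  then show ?thesis
    using powr_superadditive[of x "real k" p] assms by simp
qed

lemma word_val_base_rep_rec:
  assumes "2 \<le> a" "0 < n"
  shows "word_val b (base_rep a n) = b * word_val b (base_rep a (n div a)) + n mod a"
  using assms by (simp add: base_rep.simps[of a n] word_val_snoc)

lemma word_val_base_rep_0: "word_val b (base_rep a 0) = 0"
  by (simp add: base_rep.simps word_val_Nil)

lemma word_val_base_rep_le_powr:
  fixes e :: real
  assumes "2 \<le> a" "1 \<le> e" "real a powr e = real b"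
  shows "real (word_val b (base_rep a n)) \<le> real n powr e"
proof (induction n rule: less_induct)
  case (less n)
  show ?case
  proof (cases "n = 0")
    case True
    then show ?thesis by (simp add: word_val_base_rep_0)
  next
    case False
    define m d where "m = n div a" and "d = n mod a"
    have n: "real n = real a * real m + real d"
      by (metis m_def d_def mult_div_mod_eq of_nat_add of_nat_mult)
    have "real (word_val b (base_rep a n)) = real b * real (word_val b (base_rep a m)) + real d"
      using assms False by (simp add: word_val_base_rep_rec m_def d_def)
    also have "\<dots> \<le> real b * real m powr e + real d"
      using less.IH[of m] assms False by (simp add: m_def mult_left_mono)
    also have "\<dots> = (real a * real m) powr e + real d"
      using assms by (simp add: powr_mult)
    also have "\<dots> \<le> real n powr e"
      unfolding n using assms by (intro powr_add_nat_le) auto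
    finally show ?thesis .
  qed
qed

lemma word_val_base_rep_ge_powr:
  fixes e :: real
  assumes "2 \<le> a" "2 \<le> b" "1 \<le> e" "real a powr e = real b"
  shows "(real a - 1) / (real b - 1) * ((real n + 1) powr e - 1)
           \<le> real (word_val b (base_rep a n))"
proof (induction n rule: less_induct)
  case (less n)
  show ?case
  proof (cases "n = 0")
    case True
    then show ?thesis by (simp add: word_val_base_rep_0)
  next
    case False
    define m d where "m = n div a" and "d = n mod a"
    define c where "c = (real a - 1) / (real b - 1)"
    have n: "real n = real a * real m + real d"
      by (metis m_def d_def mult_div_mod_eq of_nat_add of_nat_mult)
    have d: "real d \<le> real a - 1"
    proof -
      have "d + 1 \<le> a"
        using assms mod_less_divisor[of a n] by (simp add: d_def Suc_le_eq)
      then show ?thesis by linarith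
    qed
    have cb: "c * (real b - 1) = real a - 1"
      using assms by (simp add: c_def)
    \<comment> \<open>\<open>u\<close> is the base of the power in the bound at \<open>n\<close>;
      \<open>v\<close> is \<open>a\<close> times the base in the bound at \<open>m\<close>, so its
      power absorbs the factor \<open>b\<close>.\<close>
    define u v where "u = real n + 1" and "v = real a * (real m + 1)"
    have v: "v powr e = real b * (real m + 1) powr e"
      using assms by (simp add: v_def powr_mult)
    have vu: "v - u = real a - 1 - real d"
      by (simp add: u_def v_def n distrib_left)
    have "v - u \<le> c * (v powr e - u powr e)"
    \<comment> \<open>Equality means that the last digit is \<open>a - 1\<close>; the slope over
      \<open>[u, v]\<close> is then degenerate.\<close>
    proof (cases "u = v")
      case True
      then show ?thesis by simp
    next
      case False
      have uv: "u < v" using False vu d by simp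
      have av: "real a \<le> v" using assms by (simp add: v_def)
      \<comment> \<open>Slopes are comparable because 1 \<le> \<open>u\<close> and \<open>a\<close>
        \<le> \<open>v\<close>; the left one equals \<open>1 / c\<close>.\<close>
      have "(real a powr e - 1 powr e) / (real a - 1) \<le> (v powr e - u powr e) / (v - u)"
        using powr_convex[OF assms(3)]
        by (rule convex_on_slope_mono) (use assms uv av in \<open>auto simp: u_def\<close>)
      then have "(real b - 1) / (real a - 1) * (v - u) \<le> v powr e - u powr e"
        using uv assms by (simp add: pos_le_divide_eq)
      then show ?thesis
        using assms by (simp add: c_def field_simps)
    qed
    then have "c * (u powr e - 1) \<le> c * (v powr e - 1) - (v - u)"
      by (simp add: algebra_simps)
    \<comment> \<open>The constants match because \<open>c * (b - 1)\<close> cancels the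
      \<open>a - 1\<close> in \<open>v - u\<close>.\<close>
    also have "\<dots> = real b * (c * ((real m + 1) powr e - 1)) + real d"
      using cb vu v by (simp add: algebra_simps)
    also have "\<dots> \<le> real b * real (word_val b (base_rep a m)) + real d"
      using less.IH[of m] assms False
      by (intro add_right_mono mult_left_mono) (auto simp: m_def c_def)
    also have "\<dots> = real (word_val b (base_rep a n))"
      using assms False by (simp add: word_val_base_rep_rec m_def d_def)
    finally show ?thesis
      by (simp add: c_def u_def)
  qed
qed

theorem theorem2:
  fixes a b n :: nat and e :: real
  assumes "2 \<le> a" and "a \<le> b"
    and "e = ln (real b) / ln (real a)"
  shows "(real a - 1) / (real b - 1) * real n powr e
           \<le> (real a - 1) / (real b - 1) * ((real n + 1) powr e - 1)
       \<and> (real a - 1) / (real b - 1) * ((real n + 1) powr e - 1)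
           \<le> real (word_val b (base_rep a n))
       \<and> real (word_val b (base_rep a n)) \<le> real n powr e"
proof (intro conjI)
  have e: "1 \<le> e"
    using assms by simp
  have ab: "real a powr e = real b"
    using assms by (simp add: powr_def)
  show "(real a - 1) / (real b - 1) * real n powr e
          \<le> (real a - 1) / (real b - 1) * ((real n + 1) powr e - 1)"
    \<comment> \<open>With \<open>k = 1\<close> this is \<open>n powr e + 1\<close> \<le>
      \<open>(n + 1) powr e\<close>.\<close>
    using powr_add_nat_le[of "real n" e 1] e assms by (intro mult_left_mono) auto
  show "(real a - 1) / (real b - 1) * ((real n + 1) powr e - 1)
          \<le> real (word_val b (base_rep a n))"
    using word_val_base_rep_ge_powr e ab assms by simp
  show "real (word_val b (base_rep a n)) \<le> real n powr e"
    using word_val_base_rep_le_powr e ab assms by simp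
qed

end
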